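(* Let $W$ be a nonnegative random variable and let $n\ge1$ be an integer. Then $$s\mapsto\mathbb{E}(1-sW)^n$$ is a proper alternate probability generating function if and only if $\mathbb{E}W^n<\infty$ and $\mathbb{E}\left[W^k(1-W)^{n-k}\right]\ge0$ for every $k\in K_n$, where $$K_n=\{k\in\{0,1,\ldots,n\}:\ n-k\text{ is odd}\}.$$
   Context: The alternate probability generating function (a.p.g.f.) of a random variable $V$ with values in $\mathbb{Z}_+=\{0,1,2,\ldots\}$ is $G_V(s)=\sum_{k\ge0}(1-s)^kP(V=k)$ (with $0^0=1$). That $s\mapsto\mathbb{E}(1-sW)^n$ is a proper a.p.g.f. means that for every $s\in[0,1]$ the expectation is well defined and equals $G_V(s)$ for some (a.s. finite) $\mathbb{Z}_+$-valued random variable $V$ not depending on $s$. *)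

theory Defs
  imports "HOL-Probability.Probability"
begin

definition apgf :: "'b measure \<Rightarrow> ('b \<Rightarrow> nat) \<Rightarrow> real \<Rightarrow> real" where
  "apgf N V s = (\<Sum>k. (1 - s) ^ k * \<P>(\<omega> in N. V \<omega> = k))"

text \<open>
  Properness, that is \<open>V < \<infinity>\<close> almost surely, is expressed by the type \<open>nat\<close> of the values of
  \<open>V\<close>. HOL cannot quantify existentially over the type of the sample space, so the sample
  space is taken to be of type \<open>nat\<close>; by \<open>proper_apgf_apgf\<close> below this is no restriction.
\<close>

definition proper_apgf :: "(real \<Rightarrow> real) \<Rightarrow> bool" where
  "proper_apgf f \<longleftrightarrow>
    (\<exists>(N :: nat measure) (V :: nat \<Rightarrow> nat).
      prob_space N \<and> V \<in> measurable N (count_space UNIV) \<and>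
      (\<forall>s\<in>{0..1}. f s = apgf N V s))"

lemma proper_apgf_apgf:
  fixes N :: "'b measure" and V :: "'b \<Rightarrow> nat"
  assumes "prob_space N" and V: "V \<in> measurable N (count_space UNIV)"
    and f: "\<And>s. s \<in> {0..1} \<Longrightarrow> f s = apgf N V s"
  shows "proper_apgf f"
proof -
  let ?D = "distr N (count_space UNIV) V"
  have "measure ?D {\<omega> \<in> space ?D. \<omega> = k} = measure N {\<omega> \<in> space N. V \<omega> = k}" for k
    using V by (subst measure_distr) (auto intro!: arg_cong[where f = "measure N"])
  then have "apgf ?D (\<lambda>\<omega>. \<omega>) s = apgf N V s" for s
    by (simp add: apgf_def)
  moreover have "prob_space ?D"
    using assms(1) V by (rule prob_space.prob_space_distr)
  moreover have "(\<lambda>\<omega>. \<omega>) \<in> measurable ?D (count_space UNIV)"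
    by simp
  ultimately show ?thesis
    using f unfolding proper_apgf_def by metis
qed

definition K :: "nat \<Rightarrow> nat set" where
  "K n = {k \<in> {0..n}. odd (n - k)}"

end

theory Submission
  imports Defs "HOL-Complex_Analysis.Cauchy_Integral_Formula"
begin

text \<open>
  The whole argument rests on the identity \<open>1 - s W = (1 - W) + (1 - s) W\<close>. Expanding its
  \<open>n\<close>-th power and integrating term by term gives
  \<open>E (1 - s W)\<^sup>n = (\<Sum>k\<le>n. p\<^sub>k (1 - s)\<^sup>k)\<close> with
  \<open>p\<^sub>k = (n choose k) E (W\<^sup>k (1 - W)\<^bsup>n-k\<^esup>)\<close> (\<open>lebesgue_integral_bernstein_expansion\<close>). Hence the only
  candidate for a law of \<open>V\<close> is \<open>P (V = k) = p\<^sub>k\<close>.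

  If the expectation is a proper alternate probability generating function, then comparing
  coefficients of powers of \<open>x = 1 - s\<close> on \<open>[0,1]\<close> (\<open>powser_eq_0_imp_coeff_eq_0\<close>) forces
  \<open>p\<^sub>k = P (V = k) \<ge> 0\<close>. Conversely, the \<open>p\<^sub>k\<close> sum to \<open>1\<close>, as one sees at \<open>s = 0\<close>, and so they
  are a probability distribution as soon as they are nonnegative. For even \<open>n - k\<close> this is
  automatic because \<open>W \<ge> 0\<close>, so only the indices in \<open>K n\<close> impose a condition.

  Given \<open>E W\<^sup>n < \<infinity>\<close>, all these expectations exist, since \<open>\<bar>W\<^sup>k (1 - W)\<^bsup>n-k\<^esup>\<bar> \<le> (1 + W)\<^sup>n\<close> and
  \<open>(1 + W)\<^sup>n \<le> 2\<^sup>n (1 + W\<^sup>n)\<close> (\<open>power_add_le_two_power\<close>). In the other direction, \<open>E W\<^sup>n < \<infinity>\<close>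
  comes from the point \<open>s = 1\<close>, where \<open>(1 - W)\<^sup>n\<close> is integrable, by the same inequality applied
  to \<open>W \<le> 1 + \<bar>1 - W\<bar>\<close>.
\<close>

lemma power_add_le_two_power:
  fixes a b :: "'a::linordered_semidom"
  assumes "0 \<le> a" "0 \<le> b"
  shows "(a + b) ^ n \<le> 2 ^ n * (a ^ n + b ^ n)"
proof -
  have "(a + b) ^ n \<le> (2 * max a b) ^ n"
    by (rule power_mono) (use assms in \<open>auto simp: mult_2 intro: add_mono\<close>)
  also have "\<dots> = 2 ^ n * max a b ^ n"
    by (simp add: power_mult_distrib)
  also have "\<dots> \<le> 2 ^ n * (a ^ n + b ^ n)"
    by (rule mult_left_mono) (use assms in \<open>auto simp: max_def\<close>)
  finally show ?thesis .
qed

text \<open>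
  Generating functions are compared on \<open>[0,1]\<close> only, so the hypothesis concerns positive \<open>x\<close>.
  Convergence there spreads to a two-sided neighbourhood of \<open>0\<close>, in which the zeros of a nonzero
  power series are isolated.
\<close>

lemma powser_eq_0_imp_coeff_eq_0:
  fixes a :: "nat \<Rightarrow> real"
  assumes r: "0 < r" and sums: "\<And>x. 0 < x \<Longrightarrow> x < r \<Longrightarrow> (\<lambda>k. a k * x ^ k) sums 0"
  shows "a m = 0"
proof (rule ccontr)
  assume am: "a m \<noteq> 0"
  define f where "f x = x * (\<Sum>k. a k * x ^ k)" for x
  \<comment> \<open>Multiplying by \<open>x\<close> makes the constant coefficient vanish, as the isolation of zeros at \<open>0\<close> needs.\<close>
  define b where "b k = (case k of 0 \<Rightarrow> 0 | Suc j \<Rightarrow> a j)" for k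
  have b_sums: "(\<lambda>k. b k * (x - 0) ^ k) sums f x" if "norm (x - 0) < r" for x
  proof -
    have "summable (\<lambda>k. a k * ((norm x + r) / 2) ^ k)"
      using that r by (intro sums_summable[OF sums]) auto
    then have "summable (\<lambda>k. a k * x ^ k)"
      by (rule powser_inside) (use that in auto)
    then have "(\<lambda>k. x * (a k * x ^ k)) sums f x"
      unfolding f_def by (intro sums_mult summable_sums)
    then have "(\<lambda>k. b (Suc k) * x ^ Suc k) sums f x"
      by (simp add: b_def mult_ac)
    from sums_Suc[OF this] show ?thesis
      by (simp add: b_def)
  qed
  have f0: "f 0 = 0" and b_Suc: "b (Suc m) \<noteq> 0"
    by (simp_all add: f_def b_def am)
  obtain s where s: "0 < s" "\<And>z. z \<in> cball 0 s - {0} \<Longrightarrow> f z \<noteq> 0"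
    using powser_0_nonzero[OF r b_sums f0 b_Suc zero_less_Suc] by blast
  let ?z = "min s (r / 2)"
  have "f ?z = 0"
    using sums[of ?z] r s(1) by (simp add: f_def sums_iff)
  moreover have "f ?z \<noteq> 0"
    by (rule s(2)) (use r s(1) in auto)
  ultimately show False by contradiction
qed

lemma integrable_power_mult_one_minus_power:
  fixes W :: "'a \<Rightarrow> real"
  assumes "finite_measure M" and [measurable]: "W \<in> borel_measurable M"
    and nonneg: "AE \<omega> in M. 0 \<le> W \<omega>" and int: "integrable M (\<lambda>\<omega>. W \<omega> ^ n)" and "k \<le> n"
  shows "integrable M (\<lambda>\<omega>. W \<omega> ^ k * (1 - W \<omega>) ^ (n - k))"
proof (rule Bochner_Integration.integrable_bound)
  interpret finite_measure M by fact
  show "integrable M (\<lambda>\<omega>. 2 ^ n * (1 ^ n + W \<omega> ^ n))"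
    using int by (intro integrable_mult_right Bochner_Integration.integrable_add) auto
  show "AE \<omega> in M. norm (W \<omega> ^ k * (1 - W \<omega>) ^ (n - k)) \<le> norm (2 ^ n * (1 ^ n + W \<omega> ^ n))"
    using nonneg
  proof eventually_elim
    case (elim \<omega>)
    have "norm (W \<omega> ^ k * (1 - W \<omega>) ^ (n - k)) = W \<omega> ^ k * \<bar>1 - W \<omega>\<bar> ^ (n - k)"
      using elim by (simp add: abs_mult power_abs)
    also have "\<dots> \<le> (1 + W \<omega>) ^ k * (1 + W \<omega>) ^ (n - k)"
      using elim by (intro mult_mono power_mono) auto
    also have "\<dots> = (1 + W \<omega>) ^ n"
      using \<open>k \<le> n\<close> by (simp flip: power_add)
    also have "\<dots> \<le> 2 ^ n * (1 ^ n + W \<omega> ^ n)"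
      by (rule power_add_le_two_power) (use elim in auto)
    also have "\<dots> \<le> norm (2 ^ n * (1 ^ n + W \<omega> ^ n))"
      by simp
    finally show ?case .
  qed
qed measurable

lemma integrable_power_if_integrable_one_minus_power:
  fixes W :: "'a \<Rightarrow> real"
  assumes "finite_measure M" and [measurable]: "W \<in> borel_measurable M"
    and int: "integrable M (\<lambda>\<omega>. (1 - W \<omega>) ^ n)"
  shows "integrable M (\<lambda>\<omega>. W \<omega> ^ n)"
proof (rule Bochner_Integration.integrable_bound)
  interpret finite_measure M by fact
  show "integrable M (\<lambda>\<omega>. 2 ^ n * (1 ^ n + norm ((1 - W \<omega>) ^ n)))"
    using int by (intro integrable_mult_right Bochner_Integration.integrable_add) auto
  show "AE \<omega> in M. norm (W \<omega> ^ n) \<le> norm (2 ^ n * (1 ^ n + norm ((1 - W \<omega>) ^ n)))"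
  proof (rule AE_I2)
    fix \<omega>
    have "norm (W \<omega> ^ n) \<le> (1 + \<bar>1 - W \<omega>\<bar>) ^ n"
      unfolding norm_power by (rule power_mono) auto
    also have "\<dots> \<le> 2 ^ n * (1 ^ n + \<bar>1 - W \<omega>\<bar> ^ n)"
      by (rule power_add_le_two_power) auto
    also have "\<dots> \<le> norm (2 ^ n * (1 ^ n + norm ((1 - W \<omega>) ^ n)))"
      by (simp add: power_abs)
    finally show "norm (W \<omega> ^ n) \<le> norm (2 ^ n * (1 ^ n + norm ((1 - W \<omega>) ^ n)))" .
  qed
qed measurable

text \<open>The \<open>k\<close>-th Bernstein polynomial of degree \<open>n\<close> integrated against the law of \<open>W\<close>.\<close>

definition bernstein_moment :: "'a measure \<Rightarrow> ('a \<Rightarrow> real) \<Rightarrow> nat \<Rightarrow> nat \<Rightarrow> real" where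
  "bernstein_moment M W n k =
    real (n choose k) * (LINT \<omega>|M. W \<omega> ^ k * (1 - W \<omega>) ^ (n - k))"

lemma bernstein_expansion:
  fixes w s :: "'a::comm_ring_1"
  shows "(1 - s * w) ^ n =
    (\<Sum>k\<le>n. of_nat (n choose k) * (w ^ k * (1 - w) ^ (n - k)) * (1 - s) ^ k)"
proof -
  have "(1 - s * w) ^ n = ((1 - s) * w + (1 - w)) ^ n"
    by (simp add: algebra_simps)
  then show ?thesis
    by (simp add: binomial_ring power_mult_distrib mult_ac)
qed

context
  fixes M :: "'a measure" and W :: "'a \<Rightarrow> real" and n :: nat
  assumes int: "\<And>k. k \<le> n \<Longrightarrow> integrable M (\<lambda>\<omega>. W \<omega> ^ k * (1 - W \<omega>) ^ (n - k))"
begin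

lemma integrable_one_minus_mult_power: "integrable M (\<lambda>\<omega>. (1 - s * W \<omega>) ^ n)"
  unfolding bernstein_expansion
  by (intro Bochner_Integration.integrable_sum integrable_mult_left integrable_mult_right int) auto

lemma lebesgue_integral_bernstein_expansion:
  "(LINT \<omega>|M. (1 - s * W \<omega>) ^ n) = (\<Sum>k\<le>n. bernstein_moment M W n k * (1 - s) ^ k)"
  unfolding bernstein_expansion bernstein_moment_def
  by (subst Bochner_Integration.integral_sum)
    (auto intro!: sum.cong integrable_mult_left integrable_mult_right int)

end

text \<open>
  The masses define a law on the natural numbers, which serves as the sample space, with the
  identity as random variable.
\<close>

lemma proper_apgf_if_finite_masses:
  fixes p :: "nat \<Rightarrow> real"
  assumes nonneg: "\<And>k. k \<le> n \<Longrightarrow> 0 \<le> p k" and sum: "(\<Sum>k\<le>n. p k) = 1"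
    and f: "\<And>s. s \<in> {0..1} \<Longrightarrow> f s = (\<Sum>k\<le>n. p k * (1 - s) ^ k)"
  shows "proper_apgf f"
proof -
  define q where "q k = (if k \<le> n then p k else 0)" for k
  have q: "0 \<le> q k" for k
    by (simp add: q_def nonneg)
  have "(\<integral>\<^sup>+ k. ennreal (q k) \<partial>count_space UNIV) = (\<Sum>k\<le>n. ennreal (q k))"
    by (rule nn_integral_count_space') (auto simp: q_def)
  also have "\<dots> = 1"
    using sum by (simp add: sum_ennreal q) (simp add: q_def)
  finally have mass: "(\<integral>\<^sup>+ k. ennreal (q k) \<partial>count_space UNIV) = 1" .
  define N where "N = measure_pmf (embed_pmf q)"
  have "apgf N id s = (\<Sum>k. (1 - s) ^ k * q k)" for s
    by (simp add: apgf_def N_def measure_pmf_single pmf_embed_pmf[OF q mass])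
  also have "(\<Sum>k. (1 - s) ^ k * q k) = (\<Sum>k\<le>n. (1 - s) ^ k * q k)" for s
    by (rule suminf_finite) (auto simp: q_def)
  also have "(\<Sum>k\<le>n. (1 - s) ^ k * q k) = (\<Sum>k\<le>n. p k * (1 - s) ^ k)" for s
    by (rule sum.cong) (auto simp: q_def)
  finally have "f s = apgf N id s" if "s \<in> {0..1}" for s
    using f[OF that] by simp
  moreover have "prob_space N"
    by (simp add: N_def measure_pmf.prob_space_axioms)
  moreover have "id \<in> measurable N (count_space UNIV)"
    by (simp add: N_def)
  ultimately show ?thesis
    unfolding proper_apgf_def by blast
qed

text \<open>
  A polynomial in \<open>1 - s\<close> is a power series too, so its coefficients must be the probabilities in the
  generating function that it equals.
\<close>

lemma coeff_nonneg_if_proper_apgf: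
  fixes p :: "nat \<Rightarrow> real"
  assumes f: "\<And>s. s \<in> {0..1} \<Longrightarrow> f s = (\<Sum>k\<le>n. p k * (1 - s) ^ k)"
    and proper: "proper_apgf f" and "m \<le> n"
  shows "0 \<le> p m"
proof -
  obtain N :: "nat measure" and V where N: "prob_space N" and V: "V \<in> measurable N (count_space UNIV)"
    and fV: "\<And>s. s \<in> {0..1} \<Longrightarrow> f s = apgf N V s"
    using proper unfolding proper_apgf_def by blast
  interpret prob_space N by fact
  define q where "q k = \<P>(\<omega> in N. V \<omega> = k)" for k
  define p' where "p' k = (if k \<le> n then p k else 0)" for k
  have "(\<lambda>k. (q k - p' k) * x ^ k) sums 0" if x: "0 < x" "x < 1" for x
  proof -
    have "summable (\<lambda>k. x ^ k * q k)"
    proof (rule summable_comparison_test')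
      show "summable (\<lambda>k. x ^ k)"
        using x by (intro summable_geometric) auto
      show "norm (x ^ k * q k) \<le> x ^ k" for k
        using x by (simp add: q_def abs_mult mult_left_le)
    qed
    then have "(\<lambda>k. x ^ k * q k) sums apgf N V (1 - x)"
      by (simp add: apgf_def q_def summable_sums)
    moreover have "apgf N V (1 - x) = (\<Sum>k\<le>n. p k * x ^ k)"
      using f[of "1 - x"] fV[of "1 - x"] x by simp
    moreover have "(\<lambda>k. x ^ k * p' k) sums (\<Sum>k\<le>n. x ^ k * p' k)"
      by (rule sums_finite) (auto simp: p'_def)
    moreover have "(\<Sum>k\<le>n. x ^ k * p' k) = (\<Sum>k\<le>n. p k * x ^ k)"
      by (rule sum.cong) (auto simp: p'_def)
    ultimately have "(\<lambda>k. x ^ k * q k - x ^ k * p' k) sums 0"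
      using sums_diff by fastforce
    then show ?thesis
      by (simp add: left_diff_distrib mult.commute[of "x ^ _"])
  qed
  from powser_eq_0_imp_coeff_eq_0[where r = 1 and m = m, OF _ this] have "q m = p m"
    using \<open>m \<le> n\<close> by (simp add: p'_def)
  then show ?thesis
    by (simp add: q_def flip: \<open>q m = p m\<close>)
qed

theorem theorem17:
  fixes M :: "'a measure" and W :: "'a \<Rightarrow> real" and n :: nat
  assumes "prob_space M"
    and "W \<in> borel_measurable M"
    and "AE \<omega> in M. 0 \<le> W \<omega>"
    and "n \<ge> 1"
  shows "((\<forall>s\<in>{0..1::real}. integrable M (\<lambda>\<omega>. (1 - s * W \<omega>) ^ n)) \<and>
          proper_apgf (\<lambda>s. LINT \<omega>|M. (1 - s * W \<omega>) ^ n))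
     \<longleftrightarrow>
         (integrable M (\<lambda>\<omega>. W \<omega> ^ n) \<and>
          (\<forall>k\<in>K n. 0 \<le> (LINT \<omega>|M. W \<omega> ^ k * (1 - W \<omega>) ^ (n - k))))"
    (is "?apgf \<longleftrightarrow> ?moments")
proof -
  interpret prob_space M by fact
  note bernstein_integrable =
    integrable_power_mult_one_minus_power[OF finite_measure_axioms assms(2,3)]
  note expansion = lebesgue_integral_bernstein_expansion[OF bernstein_integrable]
  show ?thesis
  proof
    assume L: ?apgf
    then have "integrable M (\<lambda>\<omega>. (1 - W \<omega>) ^ n)"
      by (auto dest: bspec[where x = 1])
    then have int: "integrable M (\<lambda>\<omega>. W \<omega> ^ n)"
      by (rule integrable_power_if_integrable_one_minus_power[OF finite_measure_axioms assms(2)])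
    have "0 \<le> (LINT \<omega>|M. W \<omega> ^ k * (1 - W \<omega>) ^ (n - k))" if "k \<in> K n" for k
    proof -
      have k: "k \<le> n"
        using that by (simp add: K_def)
      then have "0 \<le> bernstein_moment M W n k"
        using coeff_nonneg_if_proper_apgf[OF expansion[OF int]] L by blast
      with k show ?thesis
        by (simp add: bernstein_moment_def zero_le_mult_iff)
    qed
    with int show ?moments
      by blast
  next
    assume R: ?moments
    then have int: "integrable M (\<lambda>\<omega>. W \<omega> ^ n)" ..
    have nonneg: "0 \<le> bernstein_moment M W n k" if "k \<le> n" for k
    proof (cases "even (n - k)")
      case True
      have "0 \<le> (LINT \<omega>|M. W \<omega> ^ k * (1 - W \<omega>) ^ (n - k))"
        by (rule integral_nonneg_AE) (use assms(3) True in \<open>auto simp: zero_le_even_power\<close>)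
      then show ?thesis
        by (simp add: bernstein_moment_def)
    next
      case False
      with that have "k \<in> K n"
        by (simp add: K_def)
      with R show ?thesis
        by (simp add: bernstein_moment_def)
    qed
    have mass: "(\<Sum>k\<le>n. bernstein_moment M W n k) = 1"
      using expansion[OF int, of 0] by (simp add: prob_space)
    have "proper_apgf (\<lambda>s. LINT \<omega>|M. (1 - s * W \<omega>) ^ n)"
      by (rule proper_apgf_if_finite_masses[OF nonneg mass expansion[OF int]])
    with integrable_one_minus_mult_power[OF bernstein_integrable[OF int]] show ?apgf
      by blast
  qed
qed

end
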